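(* Let $p$ be a prime with $p\equiv1\pmod6$. Then $$\sum_{k=0}^{p-1}\frac{\binom{3k}k\binom{6k}{3k}}{432^k}\cdot\frac p{6k+1}\equiv\frac{5-2^p}3(-1)^{\frac{p-1}6}\binom{(p-1)/3}{(p-1)/6}\pmod{p^2}.$$
   Context: Congruences are taken in the ring $\mathbb Z_p$ of rational numbers whose denominators are not divisible by $p$. *)

theory Defs
  imports Complex_Main "HOL-Computational_Algebra.Primes"
begin

text \<open>The localization of the integers at the prime \<open>p\<close>; \<open>quotient_of\<close> yields the fraction
  in lowest terms.\<close>

definition p_integral_rats :: "nat \<Rightarrow> rat set" where
  "p_integral_rats p = {x. \<not> int p dvd snd (quotient_of x)}"

text \<open>The library's congruence is of no use here: on the field \<^typ>\<open>rat\<close> it is trivial for every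
  nonzero modulus.  This is congruence modulo the ideal generated by \<open>m\<close> in the ring of
  \<open>p\<close>-integral rationals, so both sides are required to lie in that ring.\<close>

definition p_integral_cong :: "nat \<Rightarrow> rat \<Rightarrow> rat \<Rightarrow> rat \<Rightarrow> bool" where
  "p_integral_cong p m x y \<longleftrightarrow>
     x \<in> p_integral_rats p \<and> y \<in> p_integral_rats p \<and>
     (\<exists>c \<in> p_integral_rats p. x - y = m * c)"

end

theory Submission
  imports Defs
begin

text \<open>Write \<open>p = 6m + 1\<close>, let \<open>u\<^sub>k = (1/6)\<^sub>k (5/6)\<^sub>k / k!\<^sup>2\<close> be the hypergeometric coefficient of the summand and
  \<open>c\<^sub>k = (-1)\<^sup>k C(m,k) C(m+k,k)\<close>, so that \<open>u\<^sub>k \<equiv> c\<^sub>k (mod p)\<close>. The only index with \<open>p\<close> dividing \<open>6k + 1\<close>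
  is \<open>k = m\<close>; hence modulo \<open>p\<^sup>2\<close> one may replace \<open>u\<^sub>k\<close> by \<open>c\<^sub>k\<close> for all \<open>k \<noteq> m\<close>. The resulting sum is
  evaluated exactly by a partial fraction decomposition at \<open>x = 1/6\<close>. With
  \<open>a = \<Prod>\<^sub>i (1 - p/(6(m+1+i)))\<close> and \<open>b = \<Prod>\<^sub>j (1 - p/(6(m-j)))\<close> over \<open>0 \<le> i, j < m\<close> it equals \<open>c\<^sub>m a/b\<close>, while \<open>u\<^sub>m = c\<^sub>m a b\<close>.
  As \<open>b \<equiv> 1 (mod p)\<close>, the harmonic sum in \<open>b\<close> cancels: \<open>b + 1/b \<equiv> 2 (mod p\<^sup>2)\<close>. So the whole sum is
  \<open>c\<^sub>m (2a - 1) \<equiv> c\<^sub>m (1 - (p/3) \<Sum>\<^sub>i 1/(m+1+i))\<close>. The harmonic sum is the alternating sum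
  \<open>\<Sum> (-1)\<^bsup>j-1\<^esup>/j\<close> over \<open>1 \<le> j \<le> 2m\<close>, and \<open>C(p,3j) \<equiv> (-1)\<^bsup>j-1\<^esup> p/(3j) (mod p\<^sup>2)\<close> turns it into
  \<open>\<Sum> C(p,3j) = (2\<^sup>p - 2)/3\<close>.\<close>

section \<open>The ring of \<open>p\<close>-integral rationals\<close>

text \<open>Any fraction with denominator prime to \<open>p\<close> will do, not only the reduced
  one. If \<open>c / d\<close> is reduced and \<open>c * b = a * d\<close>, then \<open>p\<close>
  dividing \<open>d\<close> but not \<open>b\<close> would divide \<open>c\<close>, against
  coprimality.\<close>

lemma p_integral_rats_iff:
  assumes "prime p"
  shows "x \<in> p_integral_rats p \<longleftrightarrow> (\<exists>a b. \<not> int p dvd b \<and> x = of_int a / of_int b)"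
proof
  assume "x \<in> p_integral_rats p"
  moreover obtain a b where "quotient_of x = (a, b)" by fastforce
  ultimately show "\<exists>a b. \<not> int p dvd b \<and> x = of_int a / of_int b"
    using quotient_of_div[of x a b] by (auto simp: p_integral_rats_def)
next
  assume "\<exists>a b. \<not> int p dvd b \<and> x = of_int a / of_int b"
  then obtain a b where b: "\<not> int p dvd b" and x: "x = of_int a / of_int b" by blast
  obtain c d where q: "quotient_of x = (c, d)" by fastforce
  have "(of_int c :: rat) / of_int d = of_int a / of_int b"
    using x quotient_of_div[OF q] by simp
  moreover have "b \<noteq> 0" "d \<noteq> 0" using b quotient_of_denom_pos[OF q] by auto
  ultimately have "(of_int (c * b) :: rat) = of_int (a * d)" by (simp add: field_simps)
  then have cb: "c * b = a * d" by (simp only: of_int_eq_iff)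
  have "\<not> int p dvd d"
  proof
    assume d: "int p dvd d"
    then have "int p dvd c * b" unfolding cb by simp
    with b assms have "int p dvd c" by (simp add: prime_dvd_mult_iff)
    with d quotient_of_coprime[OF q] have "is_unit (int p)" by (meson coprime_common_divisor)
    with assms show False by auto
  qed
  with q show "x \<in> p_integral_rats p" by (simp add: p_integral_rats_def)
qed

lemma p_integral_frac:
  "prime p \<Longrightarrow> \<not> int p dvd b \<Longrightarrow> of_int a / of_int b \<in> p_integral_rats p"
  by (auto simp: p_integral_rats_iff)

lemma p_integral_of_int: "prime p \<Longrightarrow> of_int a \<in> p_integral_rats p"
  using p_integral_frac[of p 1 a] by (cases "p = 1") auto

lemma p_integral_of_nat: "prime p \<Longrightarrow> of_nat n \<in> p_integral_rats p"
  using p_integral_of_int[of p "int n"] by simp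

lemma p_integral_inverse_of_int:
  "prime p \<Longrightarrow> \<not> int p dvd b \<Longrightarrow> 1 / of_int b \<in> p_integral_rats p"
  using p_integral_frac[of p b 1] by simp

lemma p_integral_inverse_of_nat:
  "prime p \<Longrightarrow> \<not> p dvd n \<Longrightarrow> 1 / of_nat n \<in> p_integral_rats p"
  using p_integral_inverse_of_int[of p "int n"] by simp

lemma p_integral_add:
  assumes "prime p" "x \<in> p_integral_rats p" "y \<in> p_integral_rats p"
  shows "x + y \<in> p_integral_rats p"
proof -
  obtain a b c d where *: "\<not> int p dvd b" "x = of_int a / of_int b"
      "\<not> int p dvd d" "y = of_int c / of_int d"
    using assms by (metis p_integral_rats_iff)
  then have "b \<noteq> 0" "d \<noteq> 0" by auto
  then have "x + y = of_int (a * d + c * b) / of_int (b * d)"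
    using * by (simp add: field_simps)
  moreover have "\<not> int p dvd b * d" using * assms by (simp add: prime_dvd_mult_iff)
  ultimately show ?thesis using assms by (metis p_integral_frac)
qed

lemma p_integral_mult:
  assumes "prime p" "x \<in> p_integral_rats p" "y \<in> p_integral_rats p"
  shows "x * y \<in> p_integral_rats p"
proof -
  obtain a b c d where *: "\<not> int p dvd b" "x = of_int a / of_int b"
      "\<not> int p dvd d" "y = of_int c / of_int d"
    using assms by (metis p_integral_rats_iff)
  then have "x * y = of_int (a * c) / of_int (b * d)" by simp
  moreover have "\<not> int p dvd b * d" using * assms by (simp add: prime_dvd_mult_iff)
  ultimately show ?thesis using assms by (metis p_integral_frac)
qed

lemma p_integral_minus:
  "prime p \<Longrightarrow> x \<in> p_integral_rats p \<Longrightarrow> - x \<in> p_integral_rats p"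
  using p_integral_mult[of p "of_int (-1)" x] p_integral_of_int[of p "-1"] by simp

lemma p_integral_diff:
  "prime p \<Longrightarrow> x \<in> p_integral_rats p \<Longrightarrow> y \<in> p_integral_rats p \<Longrightarrow> x - y \<in> p_integral_rats p"
  using p_integral_add[of p x "- y"] p_integral_minus[of p y] by simp

lemma p_integral_sum:
  "prime p \<Longrightarrow> (\<And>i. i \<in> A \<Longrightarrow> f i \<in> p_integral_rats p) \<Longrightarrow> sum f A \<in> p_integral_rats p"
  using p_integral_of_nat[of p 0]
  by (induction A rule: infinite_finite_induct) (auto intro: p_integral_add)

lemma p_integral_prod:
  "prime p \<Longrightarrow> (\<And>i. i \<in> A \<Longrightarrow> f i \<in> p_integral_rats p) \<Longrightarrow> prod f A \<in> p_integral_rats p"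
  using p_integral_of_nat[of p 1]
  by (induction A rule: infinite_finite_induct) (auto intro: p_integral_mult)

lemma p_integral_power:
  "prime p \<Longrightarrow> x \<in> p_integral_rats p \<Longrightarrow> x ^ n \<in> p_integral_rats p"
  using p_integral_prod[of p "{..<n}" "\<lambda>_. x"] by simp

section \<open>Congruences between \<open>p\<close>-integral rationals\<close>

text \<open>In this additive form the integrality of \<open>x\<close> is a consequence, so only
  \<open>y\<close> and the witness have to be checked.\<close>

lemma p_integral_cong_iff:
  "prime p \<Longrightarrow> m \<in> p_integral_rats p \<Longrightarrow>
     p_integral_cong p m x y \<longleftrightarrow>
       y \<in> p_integral_rats p \<and> (\<exists>c \<in> p_integral_rats p. x = y + m * c)"
  unfolding p_integral_cong_def
  by (auto simp: algebra_simps intro: p_integral_add p_integral_mult)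

lemma p_integral_congI:
  "prime p \<Longrightarrow> m \<in> p_integral_rats p \<Longrightarrow> y \<in> p_integral_rats p \<Longrightarrow> c \<in> p_integral_rats p \<Longrightarrow>
     x = y + m * c \<Longrightarrow> p_integral_cong p m x y"
  by (auto simp: p_integral_cong_iff)

lemma p_integral_cong_refl:
  "prime p \<Longrightarrow> x \<in> p_integral_rats p \<Longrightarrow> p_integral_cong p m x x"
  using p_integral_of_nat[of p 0] by (auto simp: p_integral_cong_def)

lemma p_integral_cong_sym:
  assumes "prime p" "p_integral_cong p m x y" shows "p_integral_cong p m y x"
proof -
  obtain c where "c \<in> p_integral_rats p" "x - y = m * c"
    using assms by (auto simp: p_integral_cong_def)
  then have "- c \<in> p_integral_rats p" "y - x = m * (- c)"
    using assms by (auto intro: p_integral_minus simp: algebra_simps)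
  then show ?thesis using assms unfolding p_integral_cong_def by blast
qed

lemma p_integral_cong_add:
  assumes "prime p" "p_integral_cong p m x y" "p_integral_cong p m x' y'"
  shows "p_integral_cong p m (x + x') (y + y')"
proof -
  obtain c c' where c: "c \<in> p_integral_rats p" "x - y = m * c"
      "c' \<in> p_integral_rats p" "x' - y' = m * c'"
    using assms by (auto simp: p_integral_cong_def)
  have "x + x' - (y + y') = (x - y) + (x' - y')" by simp
  also have "\<dots> = m * (c + c')" using c by (simp add: algebra_simps)
  finally show ?thesis
    using assms c unfolding p_integral_cong_def by (blast intro: p_integral_add)
qed

lemma p_integral_cong_trans:
  assumes "prime p" "p_integral_cong p m x y" "p_integral_cong p m y z"
  shows "p_integral_cong p m x z"
proof -
  obtain c c' where c: "c \<in> p_integral_rats p" "x - y = m * c"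
      "c' \<in> p_integral_rats p" "y - z = m * c'"
    using assms by (auto simp: p_integral_cong_def)
  have "x - z = (x - y) + (y - z)" by simp
  also have "\<dots> = m * (c + c')" using c by (simp add: algebra_simps)
  finally show ?thesis
    using assms c unfolding p_integral_cong_def by (blast intro: p_integral_add)
qed

lemma p_integral_cong_mult:
  assumes "prime p" "p_integral_cong p m x y" "p_integral_cong p m x' y'"
  shows "p_integral_cong p m (x * x') (y * y')"
proof -
  obtain c c' where c: "c \<in> p_integral_rats p" "x - y = m * c"
      "c' \<in> p_integral_rats p" "x' - y' = m * c'"
    using assms by (auto simp: p_integral_cong_def)
  have "x * x' - y * y' = (x - y) * x' + y * (x' - y')" by (simp add: algebra_simps)
  also have "\<dots> = m * (c * x' + y * c')" using c by (simp add: algebra_simps)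
  finally show ?thesis
    using assms c unfolding p_integral_cong_def by (blast intro: p_integral_add p_integral_mult)
qed

lemma p_integral_cong_cmult:
  "prime p \<Longrightarrow> c \<in> p_integral_rats p \<Longrightarrow> p_integral_cong p m x y \<Longrightarrow>
     p_integral_cong p m (c * x) (c * y)"
  by (intro p_integral_cong_mult p_integral_cong_refl)

lemma p_integral_cong_diff:
  "prime p \<Longrightarrow> p_integral_cong p m x y \<Longrightarrow> p_integral_cong p m x' y' \<Longrightarrow>
     p_integral_cong p m (x - x') (y - y')"
  using p_integral_cong_add[of p m x y "- x'" "- y'"]
    p_integral_cong_cmult[of p "of_int (-1)" m x' y'] p_integral_of_int[of p "-1"]
  by simp

lemma p_integral_cong_sum:
  "prime p \<Longrightarrow> (\<And>i. i \<in> A \<Longrightarrow> p_integral_cong p m (f i) (g i)) \<Longrightarrow>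
     p_integral_cong p m (sum f A) (sum g A)"
  using p_integral_cong_refl[of p 0 m] p_integral_of_nat[of p 0]
  by (induction A rule: infinite_finite_induct) (auto intro: p_integral_cong_add)

lemma p_integral_cong_prod:
  "prime p \<Longrightarrow> (\<And>i. i \<in> A \<Longrightarrow> p_integral_cong p m (f i) (g i)) \<Longrightarrow>
     p_integral_cong p m (prod f A) (prod g A)"
  using p_integral_cong_refl[of p 1 m] p_integral_of_nat[of p 1]
  by (induction A rule: infinite_finite_induct) (auto intro: p_integral_cong_mult)

text \<open>An explicit factor \<open>p\<close> on both sides lifts a congruence modulo
  \<open>p\<close> to one modulo \<open>p ^ 2\<close>. This is why first-order information on most
  summands is enough.\<close>

lemma p_integral_cong_raise:
  assumes "prime p" "p_integral_cong p (of_nat p) x y"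
  shows "p_integral_cong p (of_nat (p ^ 2)) (of_nat p * x) (of_nat p * y)"
proof -
  obtain c where c: "c \<in> p_integral_rats p" "x - y = of_nat p * c"
    using assms by (auto simp: p_integral_cong_def)
  have "of_nat p * x - of_nat p * y = of_nat p * (x - y)" by (simp add: algebra_simps)
  then have "of_nat p * x - of_nat p * y = of_nat (p ^ 2) * c"
    unfolding c by (simp add: power2_eq_square)
  with c assms show ?thesis
    unfolding p_integral_cong_def by (blast intro: p_integral_mult p_integral_of_nat)
qed

text \<open>First-order expansion: every product of two or more of the terms \<open>p * f i\<close>
  is divisible by \<open>p ^ 2\<close>.\<close>

lemma p_integral_cong_prod_one_plus:
  assumes "prime p" "finite A" "\<And>i. i \<in> A \<Longrightarrow> f i \<in> p_integral_rats p"
  shows "p_integral_cong p (of_nat (p ^ 2)) (\<Prod>i\<in>A. 1 + of_nat p * f i) (1 + of_nat p * sum f A)"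
  using assms(2,3)
proof (induction A rule: finite_induct)
  case empty
  show ?case using assms(1) p_integral_of_nat[of p 1] by (auto intro: p_integral_cong_refl)
next
  case (insert i A)
  have R: "f i \<in> p_integral_rats p" "sum f A \<in> p_integral_rats p"
    "of_nat p \<in> p_integral_rats p" "1 \<in> p_integral_rats p" "of_nat (p ^ 2) \<in> p_integral_rats p"
    using insert assms(1) p_integral_of_nat[of p 1]
    by (auto intro!: p_integral_sum p_integral_of_nat simp del: of_nat_power)
  have "p_integral_cong p (of_nat (p ^ 2)) (\<Prod>i\<in>insert i A. 1 + of_nat p * f i)
      ((1 + of_nat p * f i) * (1 + of_nat p * sum f A))"
    using insert R assms(1) by (auto intro!: p_integral_cong_cmult p_integral_add p_integral_mult)
  moreover have "p_integral_cong p (of_nat (p ^ 2))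
      ((1 + of_nat p * f i) * (1 + of_nat p * sum f A)) (1 + of_nat p * sum f (insert i A))"
  proof (rule p_integral_congI[OF assms(1), where c = "f i * sum f A"])
    show "(1 + of_nat p * f i) * (1 + of_nat p * sum f A) =
        1 + of_nat p * sum f (insert i A) + of_nat (p ^ 2) * (f i * sum f A)"
      using insert by (simp add: distrib_left distrib_right power2_eq_square)
    have "sum f (insert i A) \<in> p_integral_rats p"
      using insert assms(1) by (intro p_integral_sum)
    with R assms(1) show "1 + of_nat p * sum f (insert i A) \<in> p_integral_rats p"
      by (intro p_integral_add p_integral_mult)
  qed (use R assms(1) in \<open>auto intro: p_integral_mult\<close>)
  ultimately show ?case by (rule p_integral_cong_trans[OF assms(1)])
qed

section \<open>Binomial sums\<close>

lemma sum_binomial_Suc: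
  fixes f :: "nat \<Rightarrow> 'a :: comm_ring_1"
  shows "(\<Sum>k\<le>Suc n. of_nat (Suc n choose k) * f k) = (\<Sum>k\<le>n. of_nat (n choose k) * (f k + f (Suc k)))"
proof -
  have "(\<Sum>k\<le>Suc n. of_nat (Suc n choose k) * f k) =
      f 0 + (\<Sum>k\<le>n. of_nat (Suc n choose Suc k) * f (Suc k))"
    by (subst sum.atMost_Suc_shift) simp
  also have "\<dots> = (f 0 + (\<Sum>k\<le>n. of_nat (n choose Suc k) * f (Suc k)))
      + (\<Sum>k\<le>n. of_nat (n choose k) * f (Suc k))"
    by (simp add: algebra_simps sum.distrib)
  also have "f 0 + (\<Sum>k\<le>n. of_nat (n choose Suc k) * f (Suc k)) =
      (\<Sum>k\<le>Suc n. of_nat (n choose k) * f k)"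
    by (subst sum.atMost_Suc_shift) simp
  finally show ?thesis by (simp add: algebra_simps sum.distrib binomial_eq_0)
qed

text \<open>Peels one difference operator off an iterated difference. The sign is absorbed into
  \<open>f\<close>, which turns the sum in Pascal's rule into a difference.\<close>

lemma sum_alternating_binomial_Suc:
  fixes f :: "nat \<Rightarrow> 'a :: comm_ring_1"
  shows "(\<Sum>k\<le>Suc n. (-1) ^ k * of_nat (Suc n choose k) * f k) =
    (\<Sum>k\<le>n. (-1) ^ k * of_nat (n choose k) * (f k - f (Suc k)))"
  using sum_binomial_Suc[of n "\<lambda>k. (-1) ^ k * f k"] by (simp add: algebra_simps)

text \<open>Rising factorials behave under differences as powers do under derivatives: both terms
  share the factor \<open>pochhammer (z + 1) n\<close>.\<close>

lemma pochhammer_diff: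
  "pochhammer (z + 1) (Suc n) - pochhammer z (Suc n) =
     of_nat (Suc n) * pochhammer (z + 1 :: 'a :: comm_ring_1) n"
  by (subst pochhammer_rec[of z], subst pochhammer_rec') (simp add: algebra_simps)

text \<open>An m-th difference kills a polynomial in \<open>k\<close> of degree
  \<open>n < m\<close>; each difference lowers the degree by one.\<close>

lemma sum_alternating_binomial_pochhammer:
  fixes z :: "'a :: comm_ring_1"
  assumes "n < m"
  shows "(\<Sum>k\<le>m. (-1) ^ k * of_nat (m choose k) * pochhammer (z + of_nat k) n) = 0"
  using assms
proof (induction m arbitrary: n z)
  case (Suc m)
  show ?case
  proof (cases n)
    case 0
    then show ?thesis by (subst sum_alternating_binomial_Suc) simp
  next
    case (Suc n')
    have *: "pochhammer (z + of_nat k) n - pochhammer (z + of_nat (Suc k)) n =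
        - of_nat n * pochhammer ((z + 1) + of_nat k) n'" for k
      using pochhammer_diff[of "z + of_nat k" n'] Suc by (simp add: algebra_simps)
    have "(\<Sum>k\<le>Suc m. (-1) ^ k * of_nat (Suc m choose k) * pochhammer (z + of_nat k) n) =
        - of_nat n * (\<Sum>k\<le>m. (-1) ^ k * of_nat (m choose k) * pochhammer ((z + 1) + of_nat k) n')"
      unfolding sum_alternating_binomial_Suc sum_distrib_left *
      by (simp only: mult_ac)
    with Suc.IH[of n' "z + 1"] Suc Suc.prems show ?thesis by simp
  qed
qed simp

text \<open>Partial fractions of m!/(x(x+1)...(x+m)). The case \<open>Suc m\<close> is the
  difference of the case \<open>m\<close> at \<open>x\<close> and at \<open>x + 1\<close>.\<close>

lemma sum_alternating_binomial_inverse: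
  fixes x :: "'a :: field_char_0"
  assumes "\<And>k. x + of_nat k \<noteq> 0"
  shows "(\<Sum>k\<le>m. (-1) ^ k * of_nat (m choose k) * (1 / (x + of_nat k))) =
    fact m / pochhammer x (Suc m)"
  using assms
proof (induction m arbitrary: x)
  case (Suc m)
  have nz: "x + 1 + of_nat k \<noteq> 0" for k
    using Suc.prems[of "Suc k"] by (simp add: algebra_simps)
  have x: "x \<noteq> 0" using Suc.prems[of 0] by simp
  have p: "pochhammer (x + 1) m \<noteq> 0" "x + 1 + of_nat m \<noteq> 0"
    using nz by (auto simp: pochhammer_eq_0_iff eq_neg_iff_add_eq_0)
  have "(\<Sum>k\<le>Suc m. (-1) ^ k * of_nat (Suc m choose k) * (1 / (x + of_nat k))) =
     (\<Sum>k\<le>m. (-1) ^ k * of_nat (m choose k) * (1 / (x + of_nat k)))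
     - (\<Sum>k\<le>m. (-1) ^ k * of_nat (m choose k) * (1 / (x + 1 + of_nat k)))"
    unfolding sum_alternating_binomial_Suc by (simp add: algebra_simps sum_subtractf)
  also have "\<dots> = fact m / pochhammer x (Suc m) - fact m / pochhammer (x + 1) (Suc m)"
    using Suc nz by simp
  also have "\<dots> = fact (Suc m) / pochhammer x (Suc (Suc m))"
    unfolding pochhammer_rec[of x] pochhammer_Suc[of "x + 1"]
    using x p by (simp add: divide_simps) (simp add: algebra_simps)
  finally show ?case .
qed simp

text \<open>This is the partial fraction decomposition in \<open>x\<close> of the right-hand side.\<close>

lemma sum_alternating_binomial_partial_fractions:
  fixes x :: "'a :: field_char_0"
  assumes "\<And>k. x + of_nat k \<noteq> 0" "n \<le> m"
  shows "(\<Sum>k\<le>m. (-1) ^ k * of_nat (m choose k) * (pochhammer (1 + of_nat k) n / (x + of_nat k))) =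
    fact m * pochhammer (1 - x) n / pochhammer x (Suc m)"
  using assms(2)
proof (induction n)
  case 0
  then show ?case using sum_alternating_binomial_inverse[of x m] assms(1) by simp
next
  case (Suc n)
  \<comment> \<open>The new factor 1 + n + k is split as (x + k) + (1 + n - x). The first part
    cancels the denominator and leaves a polynomial of degree n < m in \<open>k\<close>, whose
    alternating sum vanishes.\<close>
  have "pochhammer (1 + of_nat k) (Suc n) / (x + of_nat k) = pochhammer (1 + of_nat k) n
      + (1 + of_nat n - x) * (pochhammer (1 + of_nat k) n / (x + of_nat k))" for k
    using assms(1)[of k] by (simp add: pochhammer_Suc field_simps)
  then have "(\<Sum>k\<le>m. (-1) ^ k * of_nat (m choose k) *
        (pochhammer (1 + of_nat k) (Suc n) / (x + of_nat k))) =
      (\<Sum>k\<le>m. (-1) ^ k * of_nat (m choose k) * pochhammer (1 + of_nat k) n)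
      + (1 + of_nat n - x) * (\<Sum>k\<le>m. (-1) ^ k * of_nat (m choose k) *
          (pochhammer (1 + of_nat k) n / (x + of_nat k)))"
    by (simp add: distrib_left sum.distrib sum_distrib_left mult_ac)
  also have "\<dots> = (1 + of_nat n - x) * (fact m * pochhammer (1 - x) n / pochhammer x (Suc m))"
    using sum_alternating_binomial_pochhammer[of n m 1] Suc by simp
  finally show ?case by (simp add: pochhammer_Suc algebra_simps)
qed

text \<open>With w a primitive cube root of unity, \<open>h k\<close> is w^k + w^(-k), and the sum
  is (1 + w)^n + (1 + w^(-1))^n for n = 6q + 1. Since 1 + w = -w^2, it equals 1. The proof stays in
  the rationals and uses only the recurrence of \<open>h\<close>.\<close>

lemma sum_binomial_omega:
  defines "h \<equiv> \<lambda>k :: nat. if 3 dvd k then 2 else - 1 :: rat"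
  shows "(\<Sum>k\<le>6 * q + 1. of_nat ((6 * q + 1) choose k) * h k) = 1"
proof -
  \<comment> \<open>The offset \<open>i\<close> stands for multiplication by w^i, so that 1 + w =
    -w^2 becomes \<open>F_Suc\<close>.\<close>
  define F where "F = (\<lambda>n i. \<Sum>k\<le>n. of_nat (n choose k) * h (k + i))"
  have h: "h k + h (Suc k) = - h (k + 2)" for k
  proof -
    have "k mod 3 = 0 \<or> k mod 3 = 1 \<or> k mod 3 = 2" by linarith
    then show ?thesis by (auto simp: h_def dvd_eq_mod_eq_0 mod_Suc)
  qed
  have F_Suc: "F (Suc n) i = - F n (i + 2)" for n i
    using h unfolding F_def sum_binomial_Suc by (simp add: sum_negf add_ac)
  \<comment> \<open>Three steps shift the offset by 6, a multiple of the period 3 of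
    \<open>h\<close>, so only the sign (-1)^3 survives.\<close>
  have F3: "F (n + 3) i = - F n i" for n i
  proof -
    have "F (n + 3) i = - F n (i + 6)"
      using F_Suc[of "n + 2" i] F_Suc[of "n + 1" "i + 2"] F_Suc[of n "i + 4"]
      by (simp add: numeral_eq_Suc)
    also have "F n (i + 6) = F n i"
      unfolding F_def h_def by (intro sum.cong) (auto, presburger+)
    finally show ?thesis .
  qed
  have "F (6 * q + 1) 0 = 1"
  proof (induction q)
    case 0
    show ?case by (simp add: F_def h_def)
  next
    case (Suc q)
    have "F (6 * Suc q + 1) 0 = F ((6 * q + 1) + 3 + 3) 0" by (simp add: algebra_simps)
    then show ?case unfolding F3 using Suc by simp
  qed
  then show ?thesis by (simp add: F_def)
qed

lemma sum_choose_multiples_of_3: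
  "(\<Sum>j = 1..2 * q. of_nat ((6 * q + 1) choose (3 * j))) = ((2 ^ (6 * q + 1) - 2) / 3 :: rat)"
proof -
  let ?n = "6 * q + 1"
  have "1 = (\<Sum>k\<le>?n. of_nat (?n choose k) * (if 3 dvd k then 2 else - 1 :: rat))"
    using sum_binomial_omega[of q] by simp
  \<comment> \<open>The weight is 3 times the indicator of the multiples of 3, minus 1; the constant
    part sums to \<open>2 ^ ?n\<close>.\<close>
  also have "\<dots> = (\<Sum>k\<le>?n. 3 * (if 3 dvd k then of_nat (?n choose k) else 0) - of_nat (?n choose k))"
    by (intro sum.cong) auto
  also have "\<dots> = 3 * (\<Sum>k\<le>?n. if 3 dvd k then of_nat (?n choose k) else 0) - 2 ^ ?n"
  proof -
    have "(\<Sum>k\<le>?n. of_nat (?n choose k) :: rat) = of_nat (2 ^ ?n)"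
      unfolding choose_row_sum[symmetric] by simp
    then show ?thesis by (simp only: sum_subtractf sum_distrib_left of_nat_power of_nat_numeral)
  qed
  also have "(\<Sum>k\<le>?n. if 3 dvd k then of_nat (?n choose k) else 0 :: rat) =
      (\<Sum>k | k \<le> ?n \<and> 3 dvd k. of_nat (?n choose k))"
    by (subst sum.inter_filter[symmetric]) auto
  also have "\<dots> = (\<Sum>j\<le>2 * q. of_nat (?n choose (3 * j)))"
    by (rule sum.reindex_bij_witness[where i = "\<lambda>j. 3 * j" and j = "\<lambda>k. k div 3"]) auto
  also have "\<dots> = 1 + (\<Sum>j = 1..2 * q. of_nat (?n choose (3 * j)))"
    by (simp add: atMost_atLeast0 sum.atLeast_Suc_atMost[of 0])
  finally show ?thesis by (simp add: field_simps)
qed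

text \<open>Passing from \<open>m\<close> to \<open>m + 1\<close> on the right drops 1/(m+1) and
  adds 1/(2m+1) + 1/(2m+2). As 1/(m+1) = 2/(2m+2), the net change is 1/(2m+1) - 1/(2m+2), the next
  two alternating terms.\<close>

lemma alternating_harmonic:
  "(\<Sum>j = 1..2 * m. (-1) ^ (j - 1) / of_nat j) = (\<Sum>i<m. 1 / of_nat (m + 1 + i) :: 'a :: field_char_0)"
proof (induction m)
  case (Suc m)
  define f where "f = (\<lambda>j. 1 / of_nat j :: 'a)"
  have "(\<Sum>i<Suc m. f (Suc m + 1 + i)) + f (m + 1) = (\<Sum>i<Suc (Suc m). f (m + 1 + i))"
    unfolding sum.lessThan_Suc_shift[of _ "Suc m"] by simp
  also have "\<dots> = (\<Sum>i<m. f (m + 1 + i)) + f (2 * m + 1) + f (2 * m + 2)"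
    by (simp add: mult_2)
  also have "f (m + 1) = 2 * f (2 * m + 2)"
  proof -
    have "of_nat (2 * m + 2) = (2 * of_nat (m + 1) :: 'a)" by simp
    then show ?thesis unfolding f_def by (simp del: of_nat_add of_nat_Suc)
  qed
  finally have *: "(\<Sum>i<Suc m. f (Suc m + 1 + i)) =
      (\<Sum>i<m. f (m + 1 + i)) + f (2 * m + 1) - f (2 * m + 2)"
    by (simp only: eq_diff_eq mult_2 add.assoc[symmetric] add_right_cancel)
  have "2 * Suc m = Suc (Suc (2 * m))" by simp
  then have "(\<Sum>j = 1..2 * Suc m. (-1) ^ (j - 1) / of_nat j) =
      (\<Sum>j = 1..2 * m. (-1) ^ (j - 1) / of_nat j) + f (2 * m + 1) - f (2 * m + 2)"
    by (simp add: f_def)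
  with * Suc.IH show ?case unfolding f_def by (simp only:)
qed simp

section \<open>Binomial coefficients in the rows of a prime and its predecessor\<close>

lemma choose_pred_prime_cong:
  assumes "prime p" "i < p"
  shows "p_integral_cong p (of_nat p) (of_nat ((p - 1) choose i)) ((-1) ^ i)"
  using assms(2)
proof (induction i)
  case 0
  show ?case using p_integral_of_nat[of p 1] assms by (auto intro: p_integral_cong_refl)
next
  case (Suc i)
  \<comment> \<open>By Pascal's rule neighbours in row \<open>p - 1\<close> add up to an entry of
    row \<open>p\<close>, which \<open>p\<close> divides; hence the sign alternates modulo
    \<open>p\<close>.\<close>
  have "p choose Suc i = ((p - 1) choose i) + ((p - 1) choose Suc i)"
    using assms(1) by (metis Suc_pred' binomial_Suc_Suc prime_gt_0_nat)
  moreover have "p dvd p choose Suc i"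
    using Suc.prems assms(1) by (intro dvd_choose_prime) auto
  ultimately obtain c where "p * c = ((p - 1) choose i) + ((p - 1) choose Suc i)"
    by (metis dvd_def)
  then have c: "of_nat p * of_nat c = (of_nat ((p - 1) choose i) + of_nat ((p - 1) choose Suc i) :: rat)"
    by (metis of_nat_add of_nat_mult)
  have "p_integral_cong p (of_nat p) (of_nat p * of_nat c) 0"
    using assms(1) p_integral_of_nat[of p 0]
    by (intro p_integral_congI[where c = "of_nat c"]) (simp_all add: p_integral_of_nat)
  moreover have "p_integral_cong p (of_nat p) (of_nat ((p - 1) choose i)) ((-1) ^ i)"
    using Suc by simp
  ultimately have "p_integral_cong p (of_nat p)
      (of_nat p * of_nat c - of_nat ((p - 1) choose i)) (0 - (-1) ^ i)"
    using assms(1) by (intro p_integral_cong_diff)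
  then show ?case unfolding c by simp
qed

text \<open>Absorption, k C(p,k) = p C(p-1,k-1), supplies one factor \<open>p\<close>; the remaining
  binomial coefficient is then needed modulo \<open>p\<close> only.\<close>

lemma choose_prime_cong:
  assumes "prime p" "0 < k" "k < p"
  shows "p_integral_cong p (of_nat (p ^ 2)) (of_nat (p choose k))
    (of_nat p * (1 / of_nat k * (-1) ^ (k - 1)))"
proof -
  have "k * (p choose k) = p * ((p - 1) choose (k - 1))"
    using times_binomial_minus1_eq assms by simp
  then have "of_nat k * of_nat (p choose k) = (of_nat p * of_nat ((p - 1) choose (k - 1)) :: rat)"
    by (metis of_nat_mult)
  then have eq: "of_nat (p choose k) = (of_nat p * (1 / of_nat k * of_nat ((p - 1) choose (k - 1))) :: rat)"
    using assms by (simp add: field_simps)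
  have "1 / of_nat k \<in> p_integral_rats p"
    using assms by (intro p_integral_inverse_of_nat) (auto dest: dvd_imp_le)
  then show ?thesis
    unfolding eq using assms
    by (intro p_integral_cong_raise p_integral_cong_cmult choose_pred_prime_cong) simp_all
qed

section \<open>The hypergeometric terms\<close>

text \<open>The two binomials multiply to (6k)!/(k! (2k)! (3k)!). Its consecutive ratio, divided by
  432, is (6k+1)(6k+5)/(36(k+1)^2).\<close>

lemma hypergeometric_term_eq:
  "of_nat ((3 * k) choose k) * of_nat ((6 * k) choose (3 * k)) / 432 ^ k =
     (\<Prod>j<k. (1 / 6 + of_nat j) * (5 / 6 + of_nat j) / of_nat (Suc j) ^ 2 :: rat)"
proof -
  have "(of_nat ((3 * k) choose k) * of_nat ((6 * k) choose (3 * k)) :: rat) =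
      fact (6 * k) / (fact k * fact (2 * k) * fact (3 * k))"
    using binomial_fact[of k "3 * k", where 'a = rat] binomial_fact[of "3 * k" "6 * k", where 'a = rat]
    by simp
  moreover have "fact (6 * k) / (fact k * fact (2 * k) * fact (3 * k)) / 432 ^ k =
     (\<Prod>j<k. (1 / 6 + of_nat j) * (5 / 6 + of_nat j) / of_nat (Suc j) ^ 2 :: rat)"
  proof (induction k)
    case (Suc k)
    \<comment> \<open>Naming the linear factors makes them atoms for the simplifier:
      \<open>c\<close>, \<open>d\<close>, \<open>e\<close> cancel, and \<open>a\<close>,
      \<open>b\<close>, \<open>g\<close> give the new factor.\<close>
    define a b c d e g :: rat
      where "a = of_nat (6 * k + 1)" and "b = of_nat (6 * k + 5)" and "c = of_nat (3 * k + 1)"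
        and "d = of_nat (2 * k + 1)" and "e = of_nat (3 * k + 2)" and "g = of_nat (Suc k)"
    note defs = this
    have nz: "c \<noteq> 0" "d \<noteq> 0" "e \<noteq> 0" "g \<noteq> 0"
      unfolding defs of_nat_eq_0_iff by simp_all
    have lin: "of_nat (6 * k + 2) = 2 * c" "of_nat (6 * k + 3) = 3 * d" "of_nat (6 * k + 4) = 2 * e"
        "of_nat (6 * k + 6) = 6 * g" "of_nat (2 * k + 2) = 2 * g" "of_nat (3 * k + 3) = 3 * g"
      by (simp_all add: defs)
    have ab: "1 / 6 + of_nat k = a / 6" "5 / 6 + of_nat k = b / 6"
      by (simp_all add: defs)
    have "6 * Suc k = Suc (Suc (Suc (Suc (Suc (Suc (6 * k))))))"
        "2 * Suc k = Suc (Suc (2 * k))" "3 * Suc k = Suc (Suc (Suc (3 * k)))"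
      by simp_all
    then have "fact (6 * Suc k) = (of_nat (6 * k + 6) * (of_nat (6 * k + 5) * (of_nat (6 * k + 4) *
          (of_nat (6 * k + 3) * (of_nat (6 * k + 2) * (of_nat (6 * k + 1) * fact (6 * k)))))) :: rat)"
        "fact (2 * Suc k) = (of_nat (2 * k + 2) * (of_nat (2 * k + 1) * fact (2 * k)) :: rat)"
        "fact (3 * Suc k) = (of_nat (3 * k + 3) * (of_nat (3 * k + 2) * (of_nat (3 * k + 1) * fact (3 * k))) :: rat)"
      by (simp_all only: fact_Suc) (simp_all add: add_ac)
    then have f: "fact (6 * Suc k) = (6 * g * (b * (2 * e * (3 * d * (2 * c * (a * fact (6 * k)))))) :: rat)"
        "fact (2 * Suc k) = (2 * g * (d * fact (2 * k)) :: rat)"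
        "fact (3 * Suc k) = (3 * g * (e * (c * fact (3 * k))) :: rat)"
        "fact (Suc k) = (g * fact k :: rat)"
      unfolding lin by (simp_all only: defs fact_Suc)
    have "fact (6 * Suc k) / (fact (Suc k) * fact (2 * Suc k) * fact (3 * Suc k)) / 432 ^ Suc k =
        fact (6 * k) / (fact k * fact (2 * k) * fact (3 * k)) / 432 ^ k * ((a / 6) * (b / 6) / g ^ 2)"
      unfolding f using nz by (simp add: divide_simps power2_eq_square)
    then show ?case unfolding prod.lessThan_Suc Suc.IH ab g_def .
  qed simp
  ultimately show ?thesis by simp
qed

lemma prod_of_nat_diff_eq:
  "(\<Prod>j<k. of_nat j - of_nat m :: 'a :: field_char_0) = (-1) ^ k * (fact k * of_nat (m choose k))"
proof -
  have "(\<Prod>j<k. of_nat j - of_nat m :: 'a) = (\<Prod>j<k. (-1) * (of_nat m - of_nat j))" by simp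
  also have "\<dots> = (-1) ^ k * (\<Prod>j<k. of_nat m - of_nat j)" by (subst prod.distrib) simp
  also have "(\<Prod>j<k. of_nat m - of_nat j :: 'a) = fact k * of_nat (m choose k)"
    by (simp add: binomial_gbinomial gbinomial_prod_rev atLeast0LessThan)
  finally show ?thesis .
qed

text \<open>The quotient \<open>pochhammer (1 + of_nat k) m / fact m\<close> is C(m+k,k), written as
  a polynomial in \<open>k\<close> to fit the partial fractions. The two splittings m! (m+1)_k = k!
  (k+1)_m of (m+k)! convert it into a product over \<open>j\<close>.\<close>

lemma alternating_choose_eq_prod:
  "(-1) ^ k * of_nat (m choose k) * pochhammer (1 + of_nat k) m / fact m =
    (\<Prod>j<k. (of_nat j - of_nat m) * (of_nat m + 1 + of_nat j) / of_nat (Suc j) ^ 2 :: rat)"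
proof -
  have f: "(\<Prod>j<k. of_nat (Suc j) :: rat) = fact k" for k
    by (simp add: fact_prod_Suc atLeast0LessThan)
  have "(\<Prod>j<k. of_nat m + 1 + of_nat j :: rat) = pochhammer (1 + of_nat m) k"
    by (simp add: pochhammer_prod atLeast0LessThan add_ac)
  moreover have "fact m * pochhammer (1 + of_nat m) k = (fact k * pochhammer (1 + of_nat k) m :: rat)"
    using pochhammer_product'[of "1 :: rat" m k] pochhammer_product'[of "1 :: rat" k m]
    by (simp add: pochhammer_fact[symmetric] add.commute)
  ultimately show ?thesis
    unfolding prod_dividef prod.distrib power2_eq_square f prod_of_nat_diff_eq by (simp add: field_simps)
qed

lemma central_choose_pochhammer:
  "of_nat ((2 * m) choose m) = (pochhammer (1 + of_nat m) m / fact m :: 'a :: field_char_0)"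
proof -
  have "fact (2 * m) = (fact m * pochhammer (1 + of_nat m) m :: 'a)"
    using pochhammer_product'[of "1 :: 'a" m m] by (simp add: pochhammer_fact[symmetric] mult_2)
  then show ?thesis using binomial_fact[of m "2 * m", where 'a = 'a] by simp
qed

section \<open>Reduction modulo the square of a prime congruent to 1 modulo 6\<close>

locale prime_1_mod_6 =
  fixes p m :: nat
  assumes prime: "prime p" and p_eq: "p = 6 * m + 1"
begin

definition u :: "nat \<Rightarrow> rat" where
  "u k = (\<Prod>j<k. (1 / 6 + of_nat j) * (5 / 6 + of_nat j) / of_nat (Suc j) ^ 2)"

text \<open>Since \<open>1/6 = p/6 - m\<close> and \<open>5/6 = m + 1 - p/6\<close>, this is \<open>u\<close> with \<open>p\<close> replaced by 0.\<close>

definition c :: "nat \<Rightarrow> rat" where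
  "c k = (\<Prod>j<k. (of_nat j - of_nat m) * (of_nat m + 1 + of_nat j) / of_nat (Suc j) ^ 2)"

text \<open>\<open>a\<close> compares (5/6)_m with (m+1)_m, and \<open>b\<close> compares (1/6)_m
  with (-m)_m. The factors have the shape 1 + p f(i) required by the first-order expansion.\<close>

definition a :: rat where
  "a = (\<Prod>i<m. 1 + of_nat p * (- (1 / 6) * (1 / of_nat (m + 1 + i))))"

definition b :: rat where
  "b = (\<Prod>j<m. 1 + of_nat p * (- (1 / 6) * (1 / of_nat (m - j))))"

lemma m_pos: "m > 0"
  using prime p_eq by (cases m) auto

lemma inverse_integral: "0 < n \<Longrightarrow> n < p \<Longrightarrow> 1 / of_nat n \<in> p_integral_rats p"
  using prime by (intro p_integral_inverse_of_nat) (auto dest: dvd_imp_le)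

lemma sixth_integral: "1 / 6 \<in> p_integral_rats p"
  using inverse_integral[of 6] p_eq m_pos by simp

lemma p_rat: "of_nat p = (6 * of_nat m + 1 :: rat)"
  by (simp add: p_eq)

text \<open>The products are compared factor by factor; \<open>k < p\<close> keeps every denominator
  \<open>Suc j\<close> prime to \<open>p\<close>.\<close>

lemma u_cong_c:
  assumes "k < p"
  shows "p_integral_cong p (of_nat p) (u k) (c k)"
  unfolding u_def c_def
proof (rule p_integral_cong_prod[OF prime])
  fix j assume "j \<in> {..<k}"
  with assms have j: "1 / of_nat (Suc j) \<in> p_integral_rats p"
    by (intro inverse_integral) auto
  have "p_integral_cong p (of_nat p) (1 / 6 + of_nat j) (of_nat j - of_nat m)"
    using prime sixth_integral
    by (intro p_integral_congI[where c = "1 / 6"] p_integral_diff p_integral_of_nat)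
      (simp_all add: p_rat add_divide_distrib)
  moreover have "p_integral_cong p (of_nat p) (5 / 6 + of_nat j) (of_nat (m + 1 + j))"
    using prime sixth_integral
    by (intro p_integral_congI[where c = "- (1 / 6)"] p_integral_minus p_integral_of_nat)
      (simp_all add: p_rat add_divide_distrib)
  ultimately have "p_integral_cong p (of_nat p)
     ((1 / of_nat (Suc j)) ^ 2 * ((1 / 6 + of_nat j) * (5 / 6 + of_nat j)))
     ((1 / of_nat (Suc j)) ^ 2 * ((of_nat j - of_nat m) * of_nat (m + 1 + j)))"
    using prime j by (intro p_integral_cong_cmult p_integral_cong_mult p_integral_power)
  then show "p_integral_cong p (of_nat p)
     ((1 / 6 + of_nat j) * (5 / 6 + of_nat j) / of_nat (Suc j) ^ 2)
     ((of_nat j - of_nat m) * (of_nat m + 1 + of_nat j) / of_nat (Suc j) ^ 2)"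
    by (simp add: power_divide add_ac)
qed

text \<open>The factor \<open>j = m\<close> vanishes. This cuts the range \<open>k < p\<close> down
  to \<open>k \<le> m\<close>, where the exact evaluation applies.\<close>

lemma c_eq_0: "k > m \<Longrightarrow> c k = 0"
  unfolding c_def by (rule prod_zero) auto

lemma c_m_eq: "c m = (-1) ^ m * of_nat ((2 * m) choose m)"
  unfolding c_def alternating_choose_eq_prod[symmetric] central_choose_pochhammer by simp

section \<open>Exact values of the middle term and of the truncated sum\<close>

lemma pochhammer_five_sixths: "pochhammer (5 / 6) m = pochhammer (1 + of_nat m) m * a"
proof -
  have "pochhammer (5 / 6) m = (\<Prod>i<m. 5 / 6 + of_nat i :: rat)"
    by (simp add: pochhammer_prod atLeast0LessThan)
  also have "\<dots> = (\<Prod>i<m. (1 + of_nat m + of_nat i) *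
      (1 + of_nat p * (- (1 / 6) * (1 / of_nat (m + 1 + i)))))"
  proof (rule prod.cong[OF refl])
    fix i
    define z :: rat where "z = of_nat (m + 1 + i)"
    have "z \<noteq> 0" unfolding z_def of_nat_eq_0_iff by simp
    then have "z * (1 + of_nat p * (- (1 / 6) * (1 / z))) = z - of_nat p / 6"
      by (simp add: right_diff_distrib)
    also have "\<dots> = 5 / 6 + of_nat i"
      by (simp add: p_rat z_def add_divide_distrib)
    finally show "5 / 6 + of_nat i = (1 + of_nat m + of_nat i) *
        (1 + of_nat p * (- (1 / 6) * (1 / of_nat (m + 1 + i)) :: rat))"
      by (simp add: z_def add_ac)
  qed
  also have "\<dots> = pochhammer (1 + of_nat m) m * a"
    by (simp add: prod.distrib a_def pochhammer_prod atLeast0LessThan)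
  finally show ?thesis .
qed

text \<open>The right-hand side expands to (j - m) + p/6. Besides factoring (1/6)_m, it shows later
  that the factors of \<open>b\<close> are invertible.\<close>

lemma sixth_factor:
  assumes "j < m"
  shows "1 / 6 + of_nat j = (of_nat j - of_nat m) *
    (1 + of_nat p * (- (1 / 6) * (1 / of_nat (m - j)) :: rat))"
proof -
  define z :: rat where "z = of_nat (m - j)"
  have "z \<noteq> 0" unfolding z_def of_nat_eq_0_iff using assms by simp
  then have "- z * (1 + of_nat p * (- (1 / 6) * (1 / z))) = - z + of_nat p / 6"
    by (simp add: right_diff_distrib)
  moreover have "of_nat j - of_nat m = - z"
    using assms by (simp add: z_def of_nat_diff)
  ultimately have "(of_nat j - of_nat m) * (1 + of_nat p * (- (1 / 6) * (1 / z))) =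
      of_nat j - of_nat m + of_nat p / 6"
    by simp
  then show ?thesis by (simp add: z_def p_rat add_divide_distrib)
qed

lemma pochhammer_sixth: "pochhammer (1 / 6) m = (-1) ^ m * fact m * b"
proof -
  have "pochhammer (1 / 6) m = (\<Prod>i<m. 1 / 6 + of_nat i :: rat)"
    by (simp add: pochhammer_prod atLeast0LessThan)
  also have "\<dots> = (\<Prod>j<m. (of_nat j - of_nat m) *
      (1 + of_nat p * (- (1 / 6) * (1 / of_nat (m - j)))))"
    by (intro prod.cong[OF refl] sixth_factor) simp
  also have "\<dots> = (-1) ^ m * fact m * b"
    by (simp add: prod.distrib prod_of_nat_diff_eq b_def)
  finally show ?thesis .
qed

lemma b_nonzero: "b \<noteq> 0"
proof -
  have "pochhammer (1 / 6 :: rat) m \<noteq> 0"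
    using pochhammer_pos[of "1 / 6 :: rat" m] by simp
  then show ?thesis unfolding pochhammer_sixth by auto
qed

lemma u_m_eq: "u m = c m * (a * b)"
proof -
  have "u m = pochhammer (1 / 6) m * pochhammer (5 / 6) m / (fact m) ^ 2"
    unfolding u_def prod_dividef prod.distrib
    by (simp add: pochhammer_prod atLeast0LessThan fact_prod_Suc power2_eq_square prod.distrib)
  then show ?thesis
    unfolding pochhammer_sixth pochhammer_five_sixths c_m_eq central_choose_pochhammer
    by (simp add: power2_eq_square)
qed

lemma sum_c_eq: "(\<Sum>k\<le>m. c k * (of_nat p / of_nat (6 * k + 1))) = c m * (a / b)"
proof -
  have nz: "(1 / 6 :: rat) + of_nat k \<noteq> 0" for k
    by (metis add_pos_nonneg of_nat_0_le_iff less_irrefl zero_less_divide_1_iff zero_less_numeral)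
  have "c k * (of_nat p / of_nat (6 * k + 1)) = (of_nat p / 6 / fact m) *
      ((-1) ^ k * of_nat (m choose k) * (pochhammer (1 + of_nat k) m / (1 / 6 + of_nat k)))" for k
  proof -
    have eq: "of_nat (6 * k + 1) = (6 * (1 / 6 + of_nat k) :: rat)" by simp
    show ?thesis
      unfolding c_def alternating_choose_eq_prod[symmetric] eq by (simp add: mult_ac del: distrib_left_numeral)
  qed
  then have "(\<Sum>k\<le>m. c k * (of_nat p / of_nat (6 * k + 1))) = (of_nat p / 6 / fact m) *
      (fact m * pochhammer (1 - 1 / 6) m / pochhammer (1 / 6) (Suc m))"
    using sum_alternating_binomial_partial_fractions[OF nz order.refl, of m]
    by (simp only: sum_distrib_left[symmetric])
  also have "\<dots> = pochhammer (5 / 6) m / pochhammer (1 / 6) m"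
  proof -
    \<comment> \<open>The last factor of (1/6)_(m+1) is p/6, which cancels the prefactor
      \<open>of_nat p / 6\<close>.\<close>
    have eq: "1 / 6 + of_nat m = (of_nat p / 6 :: rat)" by (simp add: p_rat)
    have "of_nat p \<noteq> (0 :: rat)" using prime by auto
    then show ?thesis unfolding pochhammer_Suc eq by simp
  qed
  also have "\<dots> = c m * (a / b)"
    unfolding pochhammer_sixth pochhammer_five_sixths c_m_eq central_choose_pochhammer
    by (simp add: divide_simps)
  finally show ?thesis .
qed

section \<open>Congruences modulo the square of the prime\<close>

lemma not_dvd_linear:
  assumes "k < p" "k \<noteq> m"
  shows "\<not> p dvd 6 * k + 1"
proof
  assume "p dvd 6 * k + 1"
  then obtain t where t: "6 * k + 1 = p * t" by blast
  \<comment> \<open>From \<open>k < p\<close> the cofactor \<open>t\<close> is below 6, and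
    \<open>p\<close> = 1 modulo 6 forces \<open>t\<close> = 1 modulo 6. So \<open>t = 1\<close>,
    that is \<open>k = m\<close>.\<close>
  have "p * t < p * 6" using assms t by linarith
  then have "t < 6" by simp
  moreover have "(6 * k + 1) mod 6 = (6 * (m * t) + t) mod 6"
    using t p_eq by (simp add: algebra_simps)
  then have "t mod 6 = 1" by simp
  ultimately have "t = 1" by simp
  with t p_eq assms show False by simp
qed

lemma sum_u_cong:
  "p_integral_cong p (of_nat (p ^ 2)) (\<Sum>k = 0..p - 1. u k * (of_nat p / of_nat (6 * k + 1)))
     (c m * (a * (1 / b + b) - 1))"
proof -
  define x :: "nat \<Rightarrow> rat" where "x k = of_nat p / of_nat (6 * k + 1)" for k
  have x_m: "x m = 1" unfolding x_def p_eq by (simp del: of_nat_mult of_nat_add of_nat_Suc)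
  \<comment> \<open>At \<open>k = m\<close> the weight is 1, with no factor \<open>p\<close> to
    raise a congruence modulo \<open>p\<close>; there \<open>u m\<close> is kept exactly through a
    correction term.\<close>
  have "p_integral_cong p (of_nat (p ^ 2)) (u k * x k) (c k * x k + (if k = m then u m - c m else 0))"
    if "k \<in> {0..p - 1}" for k
  proof -
    from that prime have k: "k < p" using prime_gt_0_nat[of p] by auto
    show ?thesis
    proof (cases "k = m")
      case True
      have "u m \<in> p_integral_rats p"
        using u_cong_c[OF k] True by (simp add: p_integral_cong_def)
      with x_m prime True show ?thesis by (simp add: p_integral_cong_refl)
    next
      case False
      have "p_integral_cong p (of_nat (p ^ 2)) (of_nat p * (1 / of_nat (6 * k + 1) * u k))
          (of_nat p * (1 / of_nat (6 * k + 1) * c k))"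
        using prime not_dvd_linear[OF k False] u_cong_c[OF k]
        by (intro p_integral_cong_raise p_integral_cong_cmult p_integral_inverse_of_nat)
      with False show ?thesis by (simp add: x_def mult_ac)
    qed
  qed
  then have "p_integral_cong p (of_nat (p ^ 2)) (\<Sum>k = 0..p - 1. u k * x k)
      (\<Sum>k = 0..p - 1. c k * x k + (if k = m then u m - c m else 0))"
    using prime by (intro p_integral_cong_sum)
  also have "(\<Sum>k = 0..p - 1. c k * x k + (if k = m then u m - c m else 0)) =
      (\<Sum>k = 0..p - 1. c k * x k) + (u m - c m)"
    by (simp add: sum.distrib p_eq)
  also have "(\<Sum>k = 0..p - 1. c k * x k) = (\<Sum>k\<le>m. c k * x k)"
    using c_eq_0 by (intro sum.mono_neutral_right) (auto simp: p_eq)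
  also have "(\<Sum>k\<le>m. c k * x k) + (u m - c m) = c m * (a * (1 / b + b) - 1)"
    unfolding x_def sum_c_eq u_m_eq by (simp add: algebra_simps)
  finally show ?thesis unfolding x_def .
qed

lemma a_cong:
  "p_integral_cong p (of_nat (p ^ 2)) a
     (1 - of_nat p / 6 * (\<Sum>i<m. 1 / of_nat (m + 1 + i)))"
proof -
  have "p_integral_cong p (of_nat (p ^ 2)) a
      (1 + of_nat p * (\<Sum>i<m. - (1 / 6) * (1 / of_nat (m + 1 + i))))"
    unfolding a_def using prime
    by (intro p_integral_cong_prod_one_plus p_integral_mult p_integral_minus
        sixth_integral inverse_integral) (auto simp: p_eq)
  then show ?thesis by (simp only: sum_distrib_left[symmetric]) simp
qed

text \<open>1/b + b - 2 = (b - 1)^2 / b, and \<open>b - 1\<close> is divisible by \<open>p\<close>.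
  It remains to see that \<open>1 / b\<close> is integral.\<close>

lemma b_plus_inverse_cong: "p_integral_cong p (of_nat (p ^ 2)) (1 / b + b) 2"
proof -
  have one: "1 \<in> p_integral_rats p" using p_integral_of_nat[OF prime, of 1] by simp
  have "p_integral_cong p (of_nat p) b (\<Prod>j<m. 1)"
    unfolding b_def
  proof (rule p_integral_cong_prod[OF prime])
    fix j assume "j \<in> {..<m}"
    then show "p_integral_cong p (of_nat p)
        (1 + of_nat p * (- (1 / 6) * (1 / of_nat (m - j)))) 1"
      using prime one
      by (intro p_integral_congI[where c = "- (1 / 6) * (1 / of_nat (m - j))"]
          p_integral_mult p_integral_minus p_integral_of_nat sixth_integral inverse_integral)
        (auto simp: p_eq)
  qed
  then obtain t where t: "t \<in> p_integral_rats p" "b - 1 = of_nat p * t"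
    by (auto simp: p_integral_cong_def)
  have "1 / b = (\<Prod>j<m. 1 / (1 + of_nat p * (- (1 / 6) * (1 / of_nat (m - j)))))"
    unfolding b_def by (simp add: prod_dividef)
  also have "\<dots> \<in> p_integral_rats p"
  proof (rule p_integral_prod[OF prime])
    fix j assume j: "j \<in> {..<m}"
    define y :: rat where "y = 1 + of_nat p * (- (1 / 6) * (1 / of_nat (m - j)))"
    have "1 / 6 + of_nat j = (of_nat j - of_nat m) * y"
      using sixth_factor j unfolding y_def by simp
    then have "of_nat (6 * j + 1) = 6 * (of_nat j - of_nat m) * y" by (simp add: algebra_simps)
    moreover have "of_nat (6 * j + 1) \<noteq> (0 :: rat)" unfolding of_nat_eq_0_iff by simp
    \<comment> \<open>The inverse of a factor of \<open>b\<close> is 6(j - m)/(6j + 1), whose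
      denominator lies strictly between 0 and \<open>p\<close> because \<open>j < m\<close>.\<close>
    ultimately have "1 / y = of_nat 6 * (of_nat j - of_nat m) * (1 / of_nat (6 * j + 1))"
      by auto
    also have "\<dots> \<in> p_integral_rats p"
      using prime j
      by (intro p_integral_mult p_integral_diff p_integral_of_nat inverse_integral)
        (auto simp: p_eq)
    finally show "1 / y \<in> p_integral_rats p" .
  qed
  finally have inv: "1 / b \<in> p_integral_rats p" .
  have "1 / b + b = 2 + (b - 1) * (b - 1) * (1 / b)"
    using b_nonzero by (simp add: field_simps)
  then have "1 / b + b = 2 + of_nat (p ^ 2) * (t * t * (1 / b))"
    unfolding t by (simp add: power2_eq_square)
  with t inv prime p_integral_of_nat[OF prime, of 2] show ?thesis
    by (intro p_integral_congI[where c = "t * t * (1 / b)"] p_integral_mult p_integral_of_nat) simp_all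
qed

lemma harmonic_cong:
  "p_integral_cong p (of_nat (p ^ 2)) ((2 ^ p - 2) / 3)
     (of_nat p / 3 * (\<Sum>i<m. 1 / of_nat (m + 1 + i)))"
proof -
  have "p_integral_cong p (of_nat (p ^ 2)) (\<Sum>j = 1..2 * m. of_nat (p choose (3 * j)))
      (\<Sum>j = 1..2 * m. of_nat p * (1 / of_nat (3 * j) * (-1) ^ (3 * j - 1)))"
    using prime by (intro p_integral_cong_sum choose_prime_cong) (auto simp: p_eq)
  also have "(\<Sum>j = 1..2 * m. of_nat p * (1 / of_nat (3 * j) * (-1) ^ (3 * j - 1))) =
      (\<Sum>j = 1..2 * m. of_nat p / 3 * ((-1) ^ (j - 1) / of_nat j) :: rat)"
  proof (rule sum.cong[OF refl])
    fix j assume "j \<in> {1..2 * m}"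
    \<comment> \<open>The exponents differ by an even number, so the signs agree; \<open>j\<close>
      is at least 1, so the natural subtractions are exact.\<close>
    then have "3 * j - 1 = (j - 1) + 2 * j" by auto
    then have "(-1) ^ (3 * j - 1) = ((-1) ^ (j - 1) :: rat)" by (simp only: power_add power_mult) simp
    then show "of_nat p * (1 / of_nat (3 * j) * (-1) ^ (3 * j - 1)) =
        (of_nat p / 3 * ((-1) ^ (j - 1) / of_nat j) :: rat)" by simp
  qed
  also have "\<dots> = of_nat p / 3 * (\<Sum>i<m. 1 / of_nat (m + 1 + i))"
    unfolding sum_distrib_left[symmetric] alternating_harmonic ..
  also have "(\<Sum>j = 1..2 * m. of_nat (p choose (3 * j))) = ((2 ^ p - 2) / 3 :: rat)"
    unfolding p_eq by (rule sum_choose_multiples_of_3)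
  finally show ?thesis .
qed

lemma hypergeometric_sum_cong:
  "p_integral_cong p (of_nat (p ^ 2)) (\<Sum>k = 0..p - 1. u k * (of_nat p / of_nat (6 * k + 1)))
     (c m * ((5 - 2 ^ p) / 3))"
proof -
  define \<alpha> :: rat where "\<alpha> = (\<Sum>i<m. 1 / of_nat (m + 1 + i))"
  have one: "1 \<in> p_integral_rats p" using p_integral_of_nat[OF prime, of 1] by simp
  have c: "c m \<in> p_integral_rats p"
    using u_cong_c[of m] p_eq by (auto simp: p_integral_cong_def)
  have "p_integral_cong p (of_nat (p ^ 2)) (a * (1 / b + b) - 1) ((1 - of_nat p / 6 * \<alpha>) * 2 - 1)"
    using prime one a_cong b_plus_inverse_cong unfolding \<alpha>_def
    by (intro p_integral_cong_diff p_integral_cong_mult p_integral_cong_refl)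
  \<comment> \<open>Doubling turns p/6 into p/3, exactly the multiple of the harmonic sum evaluated
    in \<open>harmonic_cong\<close>.\<close>
  also have "(1 - of_nat p / 6 * \<alpha>) * 2 - 1 = 1 - of_nat p / 3 * \<alpha>" by (simp add: field_simps)
  finally have 1: "p_integral_cong p (of_nat (p ^ 2)) (a * (1 / b + b) - 1) (1 - of_nat p / 3 * \<alpha>)" .
  have "p_integral_cong p (of_nat (p ^ 2)) (1 - of_nat p / 3 * \<alpha>) (1 - (2 ^ p - 2) / 3)"
    using prime one harmonic_cong unfolding \<alpha>_def
    by (intro p_integral_cong_diff p_integral_cong_refl p_integral_cong_sym[OF prime harmonic_cong])
  also have "1 - (2 ^ p - 2) / 3 = (5 - 2 ^ p :: rat) / 3" by (simp add: field_simps)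
  finally have 2: "p_integral_cong p (of_nat (p ^ 2)) (1 - of_nat p / 3 * \<alpha>) ((5 - 2 ^ p) / 3)" .
  show ?thesis
    using p_integral_cong_trans[OF prime sum_u_cong
        p_integral_cong_cmult[OF prime c p_integral_cong_trans[OF prime 1 2]]] .
qed

end

theorem theorem3p4:
  fixes p :: nat
  assumes "prime p" and "p mod 6 = 1"
  shows "p_integral_cong p (of_nat (p ^ 2))
           (\<Sum>k = 0..p - 1.
              of_nat ((3 * k) choose k) * of_nat ((6 * k) choose (3 * k)) / 432 ^ k
                * (of_nat p / of_nat (6 * k + 1)))
           ((5 - 2 ^ p) / 3 * (- 1) ^ ((p - 1) div 6)
              * of_nat (((p - 1) div 3) choose ((p - 1) div 6)))"
proof -
  define m where "m = p div 6"
  have p: "p = 6 * m + 1" using assms(2) unfolding m_def by presburger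
  then interpret prime_1_mod_6 p m using assms(1) by unfold_locales
  have "(p - 1) div 6 = m" "(p - 1) div 3 = 2 * m" using p by auto
  then show ?thesis
    using hypergeometric_sum_cong unfolding hypergeometric_term_eq u_def[symmetric] c_m_eq by (simp only: mult_ac)
qed

end
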